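(* Let $k\geq 4$ be an integer. If $G$ is a nontrivial connected graph with $k\ge \Delta(G)\ge 1$, then \[ i_{[kR]}(G)\ge \frac{|V(G)|(k+1)}{\Delta(G)+1}.\] Moreover, if $i_{[kR]}(G)=\frac{|V(G)|(k+1)}{\Delta(G)+1}$, then $i_{[kR]}(G)=(k+1)\,i(G)$.
   Context: All graphs are finite and simple; nontrivial means at least two vertices; $\Delta(G)$ is the maximum degree. $i(G)$ is the minimum size of an independent dominating set of $G$. For $f\colon V(G)\to\mathbb{Z}_{\ge 0}$ and $S\subseteq V(G)$, $f(S)=\sum_{v\in S}f(v)$, and $AN(v)=\{w\in N(v): f(w)\ge 1\}$. A $[k]$-Roman dominating function of $G$ is a function $f\colon V(G)\to\{0,1,\ldots,k+1\}$ such that $f(N[v])\ge k+|AN(v)|$ for every vertex $v$ with $f(v)<k$; its weight is $f(V(G))$. $i_{[kR]}(G)$ is the minimum weight of such a function whose set of vertices with positive label is independent. (The paper calls a graph with $i_{[kR]}(G)=(k+1)i(G)$ independent $[k]$-Roman.) *)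

theory Defs
  imports Complex_Main "Graph_Theory.Digraph_Component"
begin

text \<open>
  A finite simple graph is a \<^locale>\<open>pair_graph\<close>: a finite, loop-free, symmetric set of ordered
  pairs over a finite vertex set, each undirected edge being present as two opposite pairs.
\<close>

definition neighborhood :: "'a pair_pre_digraph \<Rightarrow> 'a \<Rightarrow> 'a set" where
  "neighborhood G v = {w \<in> pverts G. (v, w) \<in> parcs G}"

definition closed_neighborhood :: "'a pair_pre_digraph \<Rightarrow> 'a \<Rightarrow> 'a set" where
  "closed_neighborhood G v = insert v (neighborhood G v)"

definition max_degree :: "'a pair_pre_digraph \<Rightarrow> nat" where
  "max_degree G = Max ((\<lambda>v. card (neighborhood G v)) ` pverts G)"

definition independent_set :: "'a pair_pre_digraph \<Rightarrow> 'a set \<Rightarrow> bool" where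
  "independent_set G S \<longleftrightarrow> S \<subseteq> pverts G \<and> (\<forall>u\<in>S. \<forall>v\<in>S. (u, v) \<notin> parcs G)"

definition dominating_set :: "'a pair_pre_digraph \<Rightarrow> 'a set \<Rightarrow> bool" where
  "dominating_set G S \<longleftrightarrow> S \<subseteq> pverts G \<and> (\<forall>v\<in>pverts G - S. \<exists>u\<in>S. (v, u) \<in> parcs G)"

text \<open>
  The two minima below range over nonempty sets for every finite simple graph: a maximal
  independent set is dominating, and labelling its vertices $k+1$ and all others $0$ gives an
  independent $[k]$-Roman dominating function.
\<close>

definition independent_domination_number :: "'a pair_pre_digraph \<Rightarrow> nat" where
  "independent_domination_number G =
     (LEAST n. \<exists>S. independent_set G S \<and> dominating_set G S \<and> card S = n)"

definition active_neighborhood :: "'a pair_pre_digraph \<Rightarrow> ('a \<Rightarrow> nat) \<Rightarrow> 'a \<Rightarrow> 'a set" where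
  "active_neighborhood G f v = {w \<in> neighborhood G v. f w \<ge> 1}"

text \<open>A labelling is a total function of which only the values on the vertex set matter.\<close>

definition kRoman_dominating :: "nat \<Rightarrow> 'a pair_pre_digraph \<Rightarrow> ('a \<Rightarrow> nat) \<Rightarrow> bool" where
  "kRoman_dominating k G f \<longleftrightarrow>
     (\<forall>v\<in>pverts G. f v \<le> k + 1) \<and>
     (\<forall>v\<in>pverts G. f v < k \<longrightarrow>
        sum f (closed_neighborhood G v) \<ge> k + card (active_neighborhood G f v))"

definition independent_kRoman_dominating ::
    "nat \<Rightarrow> 'a pair_pre_digraph \<Rightarrow> ('a \<Rightarrow> nat) \<Rightarrow> bool" where
  "independent_kRoman_dominating k G f \<longleftrightarrow>
     kRoman_dominating k G f \<and> independent_set G {v \<in> pverts G. f v > 0}"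

definition independent_kRoman_domination_number :: "nat \<Rightarrow> 'a pair_pre_digraph \<Rightarrow> nat" where
  "independent_kRoman_domination_number k G =
     (LEAST n. \<exists>f. independent_kRoman_dominating k G f \<and> sum f (pverts G) = n)"

end

theory Submission
  imports Defs
begin

text \<open>
  In an independent \<open>[k]\<close>-Roman dominating function every positive label is \<open>k\<close> or \<open>k + 1\<close>, and a
  vertex labelled \<open>0\<close> has a neighbour labelled \<open>k + 1\<close> or two neighbours labelled \<open>k\<close>. Let \<open>A\<close> and
  \<open>B\<close> be the sets of vertices labelled \<open>k\<close> and \<open>k + 1\<close>. Counting edges into the vertices labelled
  \<open>0\<close>, with weight 1 from \<open>A\<close> and weight 2 from \<open>B\<close>, gives
  \<open>2 |V| \<le> (\<Delta> + 2) |A| + 2 (\<Delta> + 1) |B|\<close>. Since \<open>\<Delta> (k - 1) > 2\<close>, this yields the bound, and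
  equality forces \<open>A = {}\<close>, in which case \<open>B\<close> is an independent dominating set.
\<close>

section \<open>Neighbourhoods and the maximum degree\<close>

lemma finite_neighborhood:
  assumes "pair_graph G"
  shows "finite (neighborhood G v)"
proof -
  interpret pair_graph G by fact
  show ?thesis by (simp add: neighborhood_def)
qed

lemma neighborhood_irrefl:
  assumes "pair_graph G"
  shows "v \<notin> neighborhood G v"
proof -
  interpret pair_graph G by fact
  show ?thesis using no_loops' by (auto simp: neighborhood_def)
qed

lemma neighborhood_sym:
  assumes "pair_graph G" "v \<in> neighborhood G u"
  shows "u \<in> neighborhood G v"
proof -
  interpret pair_graph G by fact
  show ?thesis using assms(2) arcs_symmetric[of u v]
    by (auto simp: neighborhood_def dest: in_arcsD1)
qed

lemma card_neighborhood_le_max_degree: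
  assumes "pair_graph G" "v \<in> pverts G"
  shows "card (neighborhood G v) \<le> max_degree G"
proof -
  interpret pair_graph G by fact
  show ?thesis unfolding max_degree_def using assms(2) by (intro Max_ge) auto
qed

section \<open>Existence of minimisers, and the upper bound by \<open>(k + 1) * i(G)\<close>\<close>

lemma ex_independent_dominating_set:
  assumes "pair_graph G"
  shows "\<exists>S. independent_set G S \<and> dominating_set G S"
proof -
  interpret pair_graph G by fact
  let ?I = "{S. independent_set G S}"
  have "finite ?I"
    by (rule finite_subset[of _ "Pow (pverts G)"]) (auto simp: independent_set_def)
  moreover have "{} \<in> ?I"
    by (simp add: independent_set_def)
  ultimately obtain S where S: "independent_set G S"
    and max: "\<And>T. independent_set G T \<Longrightarrow> S \<subseteq> T \<Longrightarrow> S = T"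
    using finite_has_maximal[of ?I] by auto
  have "\<exists>u\<in>S. (v, u) \<in> parcs G" if v: "v \<in> pverts G - S" for v
  proof (rule ccontr)
    assume none: "\<not> ?thesis"
    then have "(u, v) \<notin> parcs G" if "u \<in> S" for u
      using that arcs_symmetric by blast
    \<comment> \<open>A vertex that \<open>S\<close> fails to dominate could be added to
      \<open>S\<close>; looplessness covers the pair \<open>(v, v)\<close>.\<close>
    with none S v have "independent_set G (insert v S)"
      using no_loops' by (auto simp: independent_set_def)
    with max v show False by blast
  qed
  with S show ?thesis
    by (auto simp: dominating_set_def independent_set_def)
qed

text \<open>The witness is \<open>k + 1\<close> on \<open>S\<close> and 0 elsewhere. A vertex
  outside \<open>S\<close> has \<open>m \<ge> 1\<close> neighbours in \<open>S\<close>, and these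
  are exactly its active ones, so the condition becomes
  \<open>k + m \<le> (k + 1) * m\<close>.\<close>

lemma independent_dominating_imp_kRoman:
  assumes "pair_graph G" "independent_set G S" "dominating_set G S"
  shows "\<exists>f. independent_kRoman_dominating k G f \<and> sum f (pverts G) = (k + 1) * card S"
proof -
  interpret pair_graph G by fact
  let ?f = "\<lambda>v. if v \<in> S then k + 1 else 0"
  have sub: "S \<subseteq> pverts G"
    using assms(2) by (simp add: independent_set_def)
  have "k + card (active_neighborhood G ?f v) \<le> sum ?f (closed_neighborhood G v)"
    if v: "v \<in> pverts G" "?f v < k" for v
  proof -
    have "v \<notin> S" using v(2) by (auto split: if_splits)
    then obtain u where "u \<in> S" "(v, u) \<in> parcs G"
      using assms(3) v(1) by (auto simp: dominating_set_def)
    with sub have u: "u \<in> neighborhood G v \<inter> S"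
      by (auto simp: neighborhood_def)
    have fin: "finite (neighborhood G v)"
      using assms(1) by (rule finite_neighborhood)
    have active: "active_neighborhood G ?f v = neighborhood G v \<inter> S"
      by (auto simp: active_neighborhood_def)
    have "sum ?f (closed_neighborhood G v) = sum ?f (neighborhood G v)"
      using fin \<open>v \<notin> S\<close> by (auto simp: closed_neighborhood_def sum.insert_if)
    also have "\<dots> = (k + 1) * card (neighborhood G v \<inter> S)"
      using fin by (simp add: sum.If_cases)
    finally have "sum ?f (closed_neighborhood G v) = (k + 1) * card (neighborhood G v \<inter> S)" .
    moreover have "card (neighborhood G v \<inter> S) \<ge> 1"
      using u fin by (simp add: Suc_le_eq card_gt_0_iff) blast
    ultimately show ?thesis using active by simp
  qed
  moreover have "{v \<in> pverts G. ?f v > 0} = S"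
    using sub by auto
  ultimately have "independent_kRoman_dominating k G ?f"
    using assms(2) by (simp add: independent_kRoman_dominating_def kRoman_dominating_def)
  moreover have "sum ?f (pverts G) = (k + 1) * card S"
    using sub by (simp add: sum.If_cases Int_absorb1)
  ultimately show ?thesis by blast
qed

lemma independent_domination_number_attained:
  assumes "pair_graph G"
  shows "\<exists>S. independent_set G S \<and> dominating_set G S \<and> card S = independent_domination_number G"
  unfolding independent_domination_number_def
  by (rule LeastI_ex) (use ex_independent_dominating_set[OF assms] in blast)

lemma independent_domination_number_le:
  assumes "independent_set G S" "dominating_set G S"
  shows "independent_domination_number G \<le> card S"
  unfolding independent_domination_number_def by (rule Least_le) (use assms in blast)

lemma independent_kRoman_domination_number_attained:
  assumes "pair_graph G"
  shows "\<exists>f. independent_kRoman_dominating k G f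
           \<and> sum f (pverts G) = independent_kRoman_domination_number k G"
  unfolding independent_kRoman_domination_number_def
  by (rule LeastI_ex)
    (use ex_independent_dominating_set[OF assms] independent_dominating_imp_kRoman[OF assms]
      in blast)

text \<open>This is one half of the equality claim; in the extremal case only the reverse inequality
  remains.\<close>

lemma independent_kRoman_domination_number_le:
  assumes "pair_graph G"
  shows "independent_kRoman_domination_number k G \<le> (k + 1) * independent_domination_number G"
proof -
  obtain S where "independent_set G S" "dominating_set G S"
    and S: "card S = independent_domination_number G"
    using independent_domination_number_attained[OF assms] by blast
  from independent_dominating_imp_kRoman[OF assms this(1,2)] show ?thesis
    unfolding independent_kRoman_domination_number_def S by (rule Least_le)
qed

section \<open>Local structure of an independent labelling\<close>

lemma independent_kRoman_label_cases:
  assumes "independent_kRoman_dominating k G f" "pair_graph G" "v \<in> pverts G"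
  shows "f v = 0 \<or> f v = k \<or> f v = k + 1"
proof (rule ccontr)
  assume neg: "\<not> ?thesis"
  have "f v \<le> k + 1"
    using assms(1,3) by (simp add: independent_kRoman_dominating_def kRoman_dominating_def)
  with neg have lt: "f v < k" "f v > 0" by auto
  \<comment> \<open>By independence a positive vertex has only neighbours labelled 0, so its closed
    neighbourhood sums to its own label, which is too small when below \<open>k\<close>.\<close>
  have "f w = 0" if "w \<in> neighborhood G v" for w
    using that assms(1,3) lt
    by (auto simp: independent_kRoman_dominating_def independent_set_def neighborhood_def)
  then have "sum f (closed_neighborhood G v) = f v"
    using finite_neighborhood[OF assms(2)] neighborhood_irrefl[OF assms(2)]
    by (simp add: closed_neighborhood_def)
  moreover have "k \<le> sum f (closed_neighborhood G v)"
    using assms(1,3) lt(1) add_leD1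
    unfolding independent_kRoman_dominating_def kRoman_dominating_def by blast
  ultimately show False
    using lt(1) by simp
qed

text \<open>With \<open>a\<close> neighbours labelled \<open>k\<close> and \<open>b\<close> labelled
  \<open>k + 1\<close>, the condition reduces to \<open>k + a \<le> k * a + k * b\<close>, which
  fails for \<open>b = 0\<close> and \<open>a \<le> 1\<close>. The alternative
  "\<open>b \<ge> 1\<close> or \<open>a \<ge> 2\<close>" is put in the linear form
  \<open>2 \<le> a + 2 * b\<close> so that it can be summed over vertices.\<close>

lemma independent_kRoman_zero_label:
  assumes "independent_kRoman_dominating k G f" "pair_graph G" "v \<in> pverts G" "f v = 0" "k > 0"
  shows "2 \<le> card {w \<in> neighborhood G v. f w = k} + 2 * card {w \<in> neighborhood G v. f w = k + 1}"
proof -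
  let ?A = "{w \<in> neighborhood G v. f w = k}" and ?B = "{w \<in> neighborhood G v. f w = k + 1}"
  have fin: "finite (neighborhood G v)"
    using assms(2) by (rule finite_neighborhood)
  have cases: "f w = 0 \<or> f w = k \<or> f w = k + 1" if "w \<in> neighborhood G v" for w
    using independent_kRoman_label_cases[OF assms(1,2)] that by (simp add: neighborhood_def)
  \<comment> \<open>Since \<open>k > 0\<close>, a neighbour labelled \<open>k\<close> is
    active.\<close>
  have active: "active_neighborhood G f v = ?A \<union> ?B"
    using assms(5) by (auto simp: active_neighborhood_def dest: cases)
  have card: "card (active_neighborhood G f v) = card ?A + card ?B"
    unfolding active using fin by (intro card_Un_disjoint) auto
  have "sum f (closed_neighborhood G v) = sum f (neighborhood G v)"
    using fin assms(4) by (simp add: closed_neighborhood_def sum.insert_if)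
  also have "\<dots> = sum f (?A \<union> ?B)"
    using fin by (intro sum.mono_neutral_right) (auto dest: cases)
  also have "\<dots> = sum f ?A + sum f ?B"
    using fin by (intro sum.union_disjoint) auto
  also have "\<dots> = k * card ?A + (k + 1) * card ?B"
    by simp
  finally have sum: "sum f (closed_neighborhood G v) = k * card ?A + (k + 1) * card ?B" .
  have "k + card (active_neighborhood G f v) \<le> sum f (closed_neighborhood G v)"
    using assms(1,3,4,5) by (simp add: independent_kRoman_dominating_def kRoman_dominating_def)
  then have "k + (card ?A + card ?B) \<le> k * card ?A + (k + 1) * card ?B"
    unfolding card sum .
  then have "k + card ?A \<le> k * card ?A + k * card ?B"
    by simp
  moreover have "a + 2 * b \<ge> 2" if "k + a \<le> k * a + k * b" for a b :: nat
  proof (rule ccontr)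
    assume "\<not> ?thesis"
    then have "b = 0" "a = 0 \<or> a = 1" by auto
    with that assms(5) show False by auto
  qed
  ultimately show ?thesis by blast
qed

section \<open>Counting by label classes\<close>

lemma sum_card_neighborhood_le:
  assumes "pair_graph G" "X \<subseteq> pverts G" "Y \<subseteq> pverts G"
  shows "(\<Sum>v\<in>X. card {w \<in> neighborhood G v. w \<in> Y}) \<le> card Y * max_degree G"
proof -
  interpret pair_graph G by fact
  have fin: "finite X" "finite Y"
    using assms(2,3) by (auto intro: finite_subset)
  have "(\<Sum>v\<in>X. card {w \<in> neighborhood G v. w \<in> Y})
      = (\<Sum>v\<in>X. card {w \<in> Y. w \<in> neighborhood G v})"
    by (intro sum.cong refl arg_cong[of _ _ card]) auto
  \<comment> \<open>Double counting of adjacent pairs: seen from \<open>Y\<close>, each vertex lies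
    in at most \<open>max_degree G\<close> of them.\<close>
  also have "\<dots> = (\<Sum>w\<in>Y. card {v \<in> X. w \<in> neighborhood G v})"
    using fin by (rule sum_multicount_gen) auto
  also have "\<dots> \<le> (\<Sum>w\<in>Y. max_degree G)"
  proof (rule sum_mono)
    fix w assume "w \<in> Y"
    have "card {v \<in> X. w \<in> neighborhood G v} \<le> card (neighborhood G w)"
      using finite_neighborhood[OF assms(1)] neighborhood_sym[OF assms(1)]
      by (intro card_mono) auto
    also have "\<dots> \<le> max_degree G"
      using assms(3) \<open>w \<in> Y\<close> by (intro card_neighborhood_le_max_degree[OF assms(1)]) auto
    finally show "card {v \<in> X. w \<in> neighborhood G v} \<le> max_degree G" .
  qed
  finally show ?thesis by simp
qed

lemma independent_kRoman_weight:
  assumes "independent_kRoman_dominating k G f" "pair_graph G" "k > 0"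
  shows "sum f (pverts G)
    = k * card {v \<in> pverts G. f v = k} + (k + 1) * card {v \<in> pverts G. f v = k + 1}"
proof -
  interpret pair_graph G by fact
  let ?A = "{v \<in> pverts G. f v = k}" and ?B = "{v \<in> pverts G. f v = k + 1}"
  have "sum f (pverts G) = sum f (?A \<union> ?B)"
    by (intro sum.mono_neutral_right) (auto dest: independent_kRoman_label_cases[OF assms(1,2)])
  also have "\<dots> = sum f ?A + sum f ?B"
    by (intro sum.union_disjoint) auto
  finally show ?thesis by simp
qed

lemma independent_kRoman_card_verts_le:
  assumes "independent_kRoman_dominating k G f" "pair_graph G" "k > 0"
  shows "2 * card (pverts G) \<le> (max_degree G + 2) * card {v \<in> pverts G. f v = k}
    + 2 * (max_degree G + 1) * card {v \<in> pverts G. f v = k + 1}"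
proof -
  interpret pair_graph G by fact
  let ?A = "{v \<in> pverts G. f v = k}" and ?B = "{v \<in> pverts G. f v = k + 1}"
    and ?Z = "{v \<in> pverts G. f v = 0}"
  have "pverts G = ?Z \<union> (?A \<union> ?B)"
    by (auto dest: independent_kRoman_label_cases[OF assms(1,2)])
  then have "card (pverts G) = card (?Z \<union> (?A \<union> ?B))"
    by (rule arg_cong)
  also have "\<dots> \<le> card ?Z + (card ?A + card ?B)"
    by (meson card_Un_le add_left_mono order_trans)
  finally have n: "card (pverts G) \<le> card ?Z + (card ?A + card ?B)" .
  have nb: "{w \<in> neighborhood G v. w \<in> {v \<in> pverts G. f v = c}} = {w \<in> neighborhood G v. f w = c}"
    for v c
    by (auto simp: neighborhood_def)
  have "2 * card ?Z = (\<Sum>v\<in>?Z. 2)"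
    by simp
  also have "\<dots> \<le> (\<Sum>v\<in>?Z. card {w \<in> neighborhood G v. f w = k}
      + 2 * card {w \<in> neighborhood G v. f w = k + 1})"
    using independent_kRoman_zero_label[OF assms(1,2)] assms(3) by (intro sum_mono) auto
  also have "\<dots> = (\<Sum>v\<in>?Z. card {w \<in> neighborhood G v. w \<in> ?A})
      + 2 * (\<Sum>v\<in>?Z. card {w \<in> neighborhood G v. w \<in> ?B})"
    by (simp only: nb sum.distrib sum_distrib_left)
  also have "\<dots> \<le> card ?A * max_degree G + 2 * (card ?B * max_degree G)"
    using assms(2) by (intro add_mono mult_left_mono sum_card_neighborhood_le) auto
  \<comment> \<open>The edge count bounds twice the number of vertices labelled 0; adding 2 for each
    vertex of \<open>?A\<close> and \<open>?B\<close> turns the coefficients \<open>D\<close> and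
    \<open>2 * D\<close>, where \<open>D\<close> is the maximum degree, into \<open>D + 2\<close>
    and \<open>2 * (D + 1)\<close>.\<close>
  finally show ?thesis
    using n by (simp add: algebra_simps)
qed

text \<open>Without the label \<open>k\<close>, the inequality \<open>2 \<le> a + 2 * b\<close> at a
  vertex labelled 0 becomes \<open>2 \<le> 2 * b\<close>, so a neighbour labelled
  \<open>k + 1\<close> exists. Independence is inherited from the set of positive vertices.\<close>

lemma independent_kRoman_no_k_dominating:
  assumes "independent_kRoman_dominating k G f" "pair_graph G" "k > 0"
    and "{v \<in> pverts G. f v = k} = {}"
  defines "B \<equiv> {v \<in> pverts G. f v = k + 1}"
  shows "independent_set G B \<and> dominating_set G B"
proof
  show "independent_set G B"
    using assms(1) by (auto simp: B_def independent_kRoman_dominating_def independent_set_def)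
  have "\<exists>u\<in>B. (v, u) \<in> parcs G" if v: "v \<in> pverts G - B" for v
  proof -
    have "f v = 0"
      using independent_kRoman_label_cases[OF assms(1,2)] v assms(4) by (auto simp: B_def)
    then have "2 \<le> card {w \<in> neighborhood G v. f w = k}
        + 2 * card {w \<in> neighborhood G v. f w = k + 1}"
      using independent_kRoman_zero_label[OF assms(1,2) _ _ assms(3)] v by simp
    moreover have "{w \<in> neighborhood G v. f w = k} = {}"
      using assms(4) by (auto simp: neighborhood_def)
    ultimately have "card {w \<in> neighborhood G v. f w = k + 1} > 0"
      by simp
    then have "{w \<in> neighborhood G v. f w = k + 1} \<noteq> {}"
      unfolding card_gt_0_iff by (rule conjunct1)
    then obtain u where "u \<in> neighborhood G v" "f u = k + 1"
      by blast
    then show ?thesis by (auto simp: B_def neighborhood_def)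
  qed
  then show "dominating_set G B"
    by (auto simp: dominating_set_def B_def)
qed

theorem theorem3p5:
  fixes k :: nat and G :: "'a pair_pre_digraph"
  assumes "k \<ge> 4"
    and "pair_graph G"
    and "Digraph_Component.connected (with_proj G)"
    and "card (pverts G) \<ge> 2"
    and "k \<ge> max_degree G" and "max_degree G \<ge> 1"
  shows "real (independent_kRoman_domination_number k G)
           \<ge> real (card (pverts G)) * (real k + 1) / (real (max_degree G) + 1)
       \<and> (real (independent_kRoman_domination_number k G)
           = real (card (pverts G)) * (real k + 1) / (real (max_degree G) + 1)
          \<longrightarrow> independent_kRoman_domination_number k G
              = (k + 1) * independent_domination_number G)"
proof -
  interpret pair_graph G by fact
  define D where "D = max_degree G"
  define w where "w = independent_kRoman_domination_number k G"
  define n where "n = card (pverts G)"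
  obtain f where f: "independent_kRoman_dominating k G f" and fw: "sum f (pverts G) = w"
    using independent_kRoman_domination_number_attained[OF assms(2)] unfolding w_def by blast
  define A where "A = {v \<in> pverts G. f v = k}"
  define B where "B = {v \<in> pverts G. f v = k + 1}"
  have k: "k > 0" using assms(1) by simp
  have w: "w = k * card A + (k + 1) * card B"
    using independent_kRoman_weight[OF f assms(2) k] fw by (simp add: A_def B_def)
  have "2 * n \<le> (D + 2) * card A + 2 * (D + 1) * card B"
    using independent_kRoman_card_verts_le[OF f assms(2) k] by (simp only: n_def A_def B_def D_def)
  \<comment> \<open>The factor \<open>k + 1\<close> makes
    \<open>(k + 1) * card B = w - k * card A\<close> available. The terms in \<open>card A\<close>
    then add up to \<open>card A * ((D + 2) - D * k)\<close>, which is split over both sides to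
    avoid subtraction on \<open>nat\<close>.\<close>
  then have "(k + 1) * (2 * n) \<le> (k + 1) * ((D + 2) * card A + 2 * (D + 1) * card B)"
    by (rule mult_left_mono) simp
  then have bound: "2 * (n * (k + 1)) + card A * (D * k) \<le> 2 * (w * (D + 1)) + card A * (D + 2)"
    by (simp add: w algebra_simps)
  have "D \<ge> 1" using assms(6) by (simp add: D_def)
  \<comment> \<open>Here \<open>k \<ge> 4\<close> enters: for \<open>D = 1\<close> the strict
    inequality \<open>D + 2 < D * k\<close> says \<open>3 < k\<close>. Strictness is what settles
    the equality case.\<close>
  then have "D + 2 < D * 4" by simp
  also have "D * 4 \<le> D * k" using assms(1) by simp
  finally have strict: "D + 2 < D * k" .
  then have "card A * (D + 2) \<le> card A * (D * k)"
    by (intro mult_left_mono) auto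
  with bound have ineq: "n * (k + 1) \<le> w * (D + 1)"
    by linarith
  have "w = (k + 1) * independent_domination_number G" if eq: "n * (k + 1) = w * (D + 1)"
  proof -
    \<comment> \<open>Under equality the main terms of \<open>bound\<close> cancel, and what is left
      contradicts \<open>strict\<close> unless \<open>card A = 0\<close>.\<close>
    have "card A * (D * k) \<le> card A * (D + 2)"
      using bound eq by linarith
    with strict have "card A = 0"
      by (metis leD mult_le_cancel1 neq0_conv)
    then have "A = {}"
      by (simp add: A_def)
    then have "independent_domination_number G \<le> card B"
      using independent_kRoman_no_k_dominating[OF f assms(2) k] independent_domination_number_le
      unfolding A_def B_def by blast
    \<comment> \<open>With \<open>A\<close> empty the weight is \<open>(k + 1) * card B\<close>, and
      \<open>B\<close> is an independent dominating set.\<close>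
    then have "(k + 1) * independent_domination_number G \<le> w"
      unfolding w \<open>card A = 0\<close> by (simp del: mult_Suc)
    with independent_kRoman_domination_number_le[OF assms(2), of k] show ?thesis
      unfolding w_def by simp
  qed
  moreover have "real n * (real k + 1) \<le> real w * (real D + 1)"
    using of_nat_mono[OF ineq, where 'a = real] by (simp add: algebra_simps)
  moreover have "n * (k + 1) = w * (D + 1)" if "real w = real n * (real k + 1) / (real D + 1)"
  proof -
    have "real (n * (k + 1)) = real (w * (D + 1))"
      using that by (simp add: field_simps)
    then show ?thesis by (simp only: of_nat_eq_iff)
  qed
  ultimately show ?thesis
    unfolding w_def[symmetric] n_def[symmetric] D_def[symmetric]
    by (auto simp: pos_divide_le_eq)
qed

end
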